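(* Let $n \ge 1$, let $m \ge 0$, let $(Q_1,\dots,Q_m)$ be a random tuple (with an arbitrary joint distribution) of ideals in the subspace lattice of $(\mathbb{F}_2)^n$, and let $f : \{0,1\}^m \to (\mathbb{F}_2)^n \setminus \{\vec 0\}$ be a function. Suppose that for every nonzero subspace $A$ of $(\mathbb{F}_2)^n$, \[ \Pr_{Q_1,\dots,Q_m}\big[\, f(1_{\{A \in Q_1\}},\dots,1_{\{A \in Q_m\}}) \in A \,\big] \ge 1/2, \] where $1_{\{A \in Q_i\}}$ is the indicator of the event $A \in Q_i$. Then $m = \Omega(n^2)$; that is, there are absolute constants $c>0$ and $n_0$ such that whenever $n \ge n_0$ and the hypothesis holds, $m \ge c n^2$.
   Context: The subspace lattice of $(\mathbb{F}_2)^n$ is the set of all linear subspaces of $(\mathbb{F}_2)^n$ ordered by inclusion. An ideal in it is a downward-closed set of subspaces: if $A$ belongs to it and $B \subseteq A$ is a subspace, then $B$ belongs to it. *)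

theory Defs
  imports "HOL-Probability.Probability"
begin

text \<open>Vectors of (F_2)^n are represented as subsets of {..<n} (a vector is identified
  with its support); vector addition over F_2 is symmetric difference, the zero
  vector is the empty set.\<close>

definition f2vec :: "nat \<Rightarrow> nat set set" where
  "f2vec n = {v. v \<subseteq> {..<n}}"

definition f2add :: "nat set \<Rightarrow> nat set \<Rightarrow> nat set" where
  "f2add u v = (u - v) \<union> (v - u)"

text \<open>A linear subspace of (F_2)^n: contains zero, closed under addition
  (scalar multiplication by 0 or 1 is then automatic).\<close>

definition f2subspace :: "nat \<Rightarrow> nat set set \<Rightarrow> bool" where
  "f2subspace n A \<longleftrightarrow> A \<subseteq> f2vec n \<and> {} \<in> A \<and> (\<forall>u\<in>A. \<forall>v\<in>A. f2add u v \<in> A)"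

definition subspace_ideal :: "nat \<Rightarrow> nat set set set \<Rightarrow> bool" where
  "subspace_ideal n Q \<longleftrightarrow> (\<forall>A\<in>Q. f2subspace n A) \<and>
     (\<forall>A\<in>Q. \<forall>B. f2subspace n B \<and> B \<subseteq> A \<longrightarrow> B \<in> Q)"

end

theory Submission
  imports Defs
begin

text \<open>
  Let \<open>A_k\<close> be the row space of a uniformly random \<open>k \<times> n\<close> matrix \<open>M\<close> over \<open>F_2\<close>, and for an
  ideal \<open>Q\<close> let \<open>p_k\<close> be the probability that \<open>A_k \<in> Q\<close>. The row space of \<open>M\<close> with an extra
  row \<open>w\<close> contains the row spaces of all matrices \<open>M + b w\<^sup>T\<close>. The noise operator
  \<open>M \<mapsto> M + b w\<^sup>T\<close> (\<open>b\<close>, \<open>w\<close> random) has the eigenvalue \<open>2\<close> to the power \<open>- rank Y\<close> at the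
  character \<open>Y\<close>, hence spectral gap \<open>1/2\<close>, and Cauchy-Schwarz gives that the odds
  \<open>p_k / (1 - p_k)\<close> at least halve when \<open>k\<close> increases by one. So the entropies of the
  events \<open>A_k \<in> Q\<close>, summed over all \<open>k\<close>, are \<open>O(1)\<close> for each ideal.

  Conversely, a fixed nonzero vector lies in \<open>A_k\<close> with probability at most \<open>2 ^ k / 2 ^ n\<close>,
  so for each \<open>k \<le> n / 2\<close> the answers to the \<open>m\<close> queries must have total entropy \<open>\<Omega>(n)\<close> for
  the guess to succeed with constant probability. Summing over \<open>k\<close> gives \<open>m = \<Omega>(n\<^sup>2)\<close>.
\<close>

section \<open>Characters of F_2 vector spaces\<close>

text \<open>Vectors and matrices over \<open>F_2\<close> are identified with their supports, so a matrix is a set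
  of index pairs, addition is \<open>sym_diff\<close>, and the rank-one matrix \<open>b w\<^sup>T\<close> is \<open>b \<times> w\<close>.\<close>

definition chi :: "'a set \<Rightarrow> 'a set \<Rightarrow> real" where
  "chi Y M = (-1) ^ card (Y \<inter> M)"

lemma chi_commute: "chi Y M = chi M Y"
  by (simp add: chi_def Int_commute)

lemma chi_empty [simp]: "chi {} M = 1" "chi Y {} = 1"
  by (simp_all add: chi_def)

lemma minus_one_power_card_eq_prod:
  "finite A \<Longrightarrow> (-1 :: real) ^ card (Y \<inter> A) = (\<Prod>x\<in>A. if x \<in> Y then -1 else 1)"
  by (simp add: prod.If_cases Int_commute)

lemma card_sym_diff_add:
  assumes "finite A" "finite B"
  shows "card (sym_diff A B) + 2 * card (A \<inter> B) = card A + card B"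
proof -
  have "card (sym_diff A B) = card (A - B) + card (B - A)"
    using assms by (intro card_Un_disjoint) auto
  moreover have "card A = card (A - B) + card (A \<inter> B)"
    using assms by (metis card_Int_Diff add.commute)
  moreover have "card B = card (B - A) + card (A \<inter> B)"
    using assms by (metis card_Int_Diff add.commute Int_commute)
  ultimately show ?thesis by simp
qed

lemma even_card_sym_diff:
  assumes "finite A" "finite B"
  shows "even (card (sym_diff A B)) \<longleftrightarrow> (even (card A) \<longleftrightarrow> even (card B))"
  using card_sym_diff_add[OF assms] by (metis even_add even_mult_iff dvd_refl)

lemma chi_sym_diff:
  assumes "finite Y"
  shows "chi Y (sym_diff A B) = chi Y A * chi Y B"
proof -
  have "Y \<inter> sym_diff A B = sym_diff (Y \<inter> A) (Y \<inter> B)" by auto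
  then show ?thesis
    using even_card_sym_diff[of "Y \<inter> A" "Y \<inter> B"] assms
    by (auto simp: chi_def minus_one_power_iff)
qed

lemma bij_betw_sym_diff:
  assumes "D \<subseteq> U"
  shows "bij_betw (\<lambda>M. sym_diff M D) (Pow U) (Pow U)"
  by (rule bij_betw_byWitness[where f' = "\<lambda>M. sym_diff M D"]) (use assms in auto)

text \<open>Translation invariance of the uniform measure, the source of every change of variables
  below.\<close>

lemma sum_Pow_sym_diff:
  assumes "D \<subseteq> U"
  shows "(\<Sum>M\<in>Pow U. h (sym_diff M D)) = (\<Sum>M\<in>Pow U. h M)"
  using sum.reindex_bij_betw[OF bij_betw_sym_diff[OF assms], of h] .

text \<open>Orthogonality of characters: translation by a point of \<open>C \<inter> U\<close> flips
  the sign of every term, so the sum equals its own negative.\<close>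

lemma sum_chi:
  assumes "finite U"
  shows "(\<Sum>M\<in>Pow U. chi C M) = (if C \<inter> U = {} then 2 ^ card U else 0)"
proof (cases "C \<inter> U = {}")
  case True
  then have "chi C M = 1" if "M \<in> Pow U" for M
    using that by (auto simp: chi_def) (metis Int_assoc card.empty inf.absorb_iff2 inf_bot_left power_0 Int_commute)
  then show ?thesis using True assms by (simp add: card_Pow)
next
  case False
  then obtain x where x: "x \<in> C" "x \<in> U" by auto
  have "chi C (sym_diff M {x}) = - chi C M" if "M \<in> Pow U" for M
  proof -
    have "C \<inter> sym_diff M {x} = sym_diff (C \<inter> M) {x}" using x by auto
    moreover have "finite (C \<inter> M)" using that assms by (auto intro: finite_subset)
    ultimately show ?thesis
      using even_card_sym_diff[of "C \<inter> M" "{x}"] by (simp add: chi_def minus_one_power_iff)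
  qed
  then have "(\<Sum>M\<in>Pow U. chi C (sym_diff M {x})) = - (\<Sum>M\<in>Pow U. chi C M)"
    by (simp add: sum_negf)
  moreover have "(\<Sum>M\<in>Pow U. chi C (sym_diff M {x})) = (\<Sum>M\<in>Pow U. chi C M)"
    using x by (intro sum_Pow_sym_diff) auto
  ultimately show ?thesis using False by simp
qed

text \<open>Expanding the square and summing over \<open>Y\<close> first, orthogonality keeps only
  the pairs with \<open>M' = sym_diff M D\<close>. The case \<open>D = {}\<close> is Parseval's
  identity.\<close>

lemma autocorrelation_fourier:
  assumes U: "finite U" and D: "D \<subseteq> U"
  shows "(\<Sum>Y\<in>Pow U. (\<Sum>M\<in>Pow U. g M * chi Y M)\<^sup>2 * chi Y D)
         = 2 ^ card U * (\<Sum>M\<in>Pow U. g M * g (sym_diff M D))"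
proof -
  have fin: "finite X" if "X \<in> Pow U" for X using that U by (auto intro: finite_subset)
  have *: "(\<Sum>M\<in>Pow U. g M * chi Y M)\<^sup>2 * chi Y D
      = (\<Sum>M\<in>Pow U. \<Sum>M'\<in>Pow U. g M * g M' * chi (sym_diff (sym_diff M D) M') Y)"
    if "Y \<in> Pow U" for Y
  proof -
    have "chi (sym_diff (sym_diff M D) M') Y = chi Y M * chi Y D * chi Y M'" for M M'
      by (subst chi_commute) (simp only: chi_sym_diff[OF fin[OF that]])
    then show ?thesis
      unfolding power2_eq_square sum_product sum_distrib_right
      by (intro sum.cong refl) (simp add: sum_distrib_left mult_ac)
  qed
  have **: "(\<Sum>Y\<in>Pow U. chi (sym_diff (sym_diff M D) M') Y)
      = (if M' = sym_diff M D then 2 ^ card U else 0)"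
    if "M \<in> Pow U" "M' \<in> Pow U" for M M'
  proof -
    have "sym_diff (sym_diff M D) M' \<inter> U = {} \<longleftrightarrow> M' = sym_diff M D"
      using that D by blast
    then show ?thesis using sum_chi[OF U, of "sym_diff (sym_diff M D) M'"] by presburger
  qed
  have "(\<Sum>Y\<in>Pow U. (\<Sum>M\<in>Pow U. g M * chi Y M)\<^sup>2 * chi Y D)
    = (\<Sum>Y\<in>Pow U. \<Sum>M\<in>Pow U. \<Sum>M'\<in>Pow U. g M * g M' * chi (sym_diff (sym_diff M D) M') Y)"
    by (rule sum.cong[OF refl *])
  also have "\<dots> = (\<Sum>M\<in>Pow U. \<Sum>M'\<in>Pow U. \<Sum>Y\<in>Pow U. g M * g M' * chi (sym_diff (sym_diff M D) M') Y)"
    by (subst sum.swap, rule sum.cong[OF refl], rule sum.swap)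
  also have "\<dots> = (\<Sum>M\<in>Pow U. \<Sum>M'\<in>Pow U. g M * g M' * (if M' = sym_diff M D then 2 ^ card U else 0))"
    by (intro sum.cong refl) (simp only: sum_distrib_left[symmetric] **)
  also have "\<dots> = (\<Sum>M\<in>Pow U. g M * g (sym_diff M D) * 2 ^ card U)"
  proof (rule sum.cong[OF refl])
    fix M assume "M \<in> Pow U"
    then have "sym_diff M D \<in> Pow U" using D by auto
    moreover have "finite (Pow U)" using U by simp
    ultimately show "(\<Sum>M'\<in>Pow U. g M * g M' * (if M' = sym_diff M D then 2 ^ card U else 0))
        = g M * g (sym_diff M D) * 2 ^ card U"
      by (simp add: if_distrib[of "\<lambda>x. _ * x"] sum.delta cong: if_cong)
  qed
  finally show ?thesis by (simp add: sum_distrib_left mult_ac)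
qed

subsection \<open>Rank-one noise\<close>

text \<open>The row vector \<open>b\<close>^T \<open>M\<close> over F_2, that is, the sum of the
  rows of \<open>M\<close> indexed by \<open>b\<close>.\<close>

definition lincomb :: "'a set \<Rightarrow> ('a \<times> 'b) set \<Rightarrow> 'b set" where
  "lincomb b M = {j. odd (card {i\<in>b. (i, j) \<in> M})}"

text \<open>Both sides are the sign of the bilinear form \<open>b\<close>^T \<open>Y\<close>
  \<open>w\<close>, evaluated column by column.\<close>

lemma chi_Times:
  assumes "finite b" "finite w"
  shows "chi Y (b \<times> w) = chi (lincomb b Y) w"
proof -
  have "Y \<inter> b \<times> w = (\<Union>j\<in>w. (\<lambda>i. (i, j)) ` {i\<in>b. (i, j) \<in> Y})" by auto
  also have "card \<dots> = (\<Sum>j\<in>w. card ((\<lambda>i. (i, j)) ` {i\<in>b. (i, j) \<in> Y}))"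
    using assms by (intro card_UN_disjoint) auto
  also have "\<dots> = (\<Sum>j\<in>w. card {i\<in>b. (i, j) \<in> Y})"
    by (intro sum.cong refl card_image) (auto simp: inj_on_def)
  finally have "chi Y (b \<times> w) = (\<Prod>j\<in>w. (-1) ^ card {i\<in>b. (i, j) \<in> Y})"
    by (simp add: chi_def power_sum)
  also have "\<dots> = (\<Prod>j\<in>w. if j \<in> lincomb b Y then -1 else 1)"
    by (intro prod.cong refl) (auto simp: lincomb_def)
  finally show ?thesis
    using assms by (simp add: chi_def minus_one_power_card_eq_prod)
qed

text \<open>The sum over \<open>w\<close> vanishes unless \<open>b\<close>^T \<open>Y\<close> is
  zero on \<open>N\<close>. This forces \<open>b\<close> to be orthogonal to a fixed nonzero column
  \<open>C\<close> of \<open>Y\<close>, which holds for exactly half of all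
  \<open>b\<close>.\<close>

lemma sum_chi_Times_le:
  assumes K: "finite K" and N: "finite N" and Y: "Y \<subseteq> K \<times> N" "Y \<noteq> {}"
  shows "(\<Sum>b\<in>Pow K. \<Sum>w\<in>Pow N. chi Y (b \<times> w)) \<le> 2 ^ card K * 2 ^ card N / 2"
proof -
  obtain i0 j0 where ij: "(i0, j0) \<in> Y" "i0 \<in> K" "j0 \<in> N" using Y by auto
  define C where "C = {i. (i, j0) \<in> Y}"
  have "(\<Sum>w\<in>Pow N. chi Y (b \<times> w)) \<le> 2 ^ card N * ((1 + chi C b) / 2)" if "b \<in> Pow K" for b
  proof -
    have b: "finite b" using that K by (auto intro: finite_subset)
    have "(\<Sum>w\<in>Pow N. chi Y (b \<times> w)) = (\<Sum>w\<in>Pow N. chi (lincomb b Y) w)"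
      using N b by (intro sum.cong refl chi_Times) (auto intro: finite_subset)
    also have "\<dots> = (if lincomb b Y \<inter> N = {} then 2 ^ card N else 0)"
      by (rule sum_chi[OF N])
    also have "\<dots> \<le> (if j0 \<in> lincomb b Y then 0 else 2 ^ card N)" using ij by auto
    also have "\<dots> = 2 ^ card N * ((1 + chi C b) / 2)"
    proof -
      have "C \<inter> b = {i\<in>b. (i, j0) \<in> Y}" by (auto simp: C_def)
      then show ?thesis by (auto simp: chi_def lincomb_def)
    qed
    finally show ?thesis .
  qed
  then have "(\<Sum>b\<in>Pow K. \<Sum>w\<in>Pow N. chi Y (b \<times> w)) \<le> (\<Sum>b\<in>Pow K. 2 ^ card N * ((1 + chi C b) / 2))"
    by (rule sum_mono)
  also have "\<dots> = 2 ^ card N / 2 * (\<Sum>b\<in>Pow K. 1 + chi C b)"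
    by (simp add: sum_distrib_left)
  also have "(\<Sum>b\<in>Pow K. 1 + chi C b) = 2 ^ card K"
  proof -
    have "C \<inter> K \<noteq> {}" using ij by (auto simp: C_def)
    then show ?thesis using sum_chi[OF K, of C] K by (simp add: sum.distrib card_Pow)
  qed
  finally show ?thesis by (simp add: mult_ac)
qed

text \<open>In the Fourier basis the noise is diagonal, with eigenvalue 1 at the trivial character
  and at most 1/2 elsewhere. The result is half the total energy plus another half of the energy of
  the mean.\<close>

lemma rank_one_noise:
  fixes g :: "('a \<times> 'b) set \<Rightarrow> real"
  assumes K: "finite K" and N: "finite N"
  defines "U \<equiv> K \<times> N"
  shows "(\<Sum>b\<in>Pow K. \<Sum>w\<in>Pow N. \<Sum>M\<in>Pow U. g M * g (sym_diff M (b \<times> w)))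
      \<le> 2 ^ card K * 2 ^ card N *
          ((\<Sum>M\<in>Pow U. (g M)\<^sup>2) + (\<Sum>M\<in>Pow U. g M)\<^sup>2 / 2 ^ card U) / 2"
proof -
  have U: "finite U" using K N by (simp add: U_def)
  define G where "G Y = (\<Sum>M\<in>Pow U. g M * chi Y M)\<^sup>2" for Y
  have fourier: "2 ^ card U * (\<Sum>M\<in>Pow U. g M * g (sym_diff M D)) = (\<Sum>Y\<in>Pow U. G Y * chi Y D)"
    if "D \<subseteq> U" for D
    using autocorrelation_fourier[OF U that, of g] by (simp add: G_def)
  have G0: "G {} = (\<Sum>M\<in>Pow U. g M)\<^sup>2" by (simp add: G_def)
  have parseval: "(\<Sum>Y\<in>Pow U. G Y) = 2 ^ card U * (\<Sum>M\<in>Pow U. (g M)\<^sup>2)"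
    using fourier[of "{}"] by (simp add: power2_eq_square)
  define BN :: real where "BN = 2 ^ card K * 2 ^ card N"
  have "2 ^ card U * (\<Sum>b\<in>Pow K. \<Sum>w\<in>Pow N. \<Sum>M\<in>Pow U. g M * g (sym_diff M (b \<times> w)))
     = (\<Sum>b\<in>Pow K. \<Sum>w\<in>Pow N. 2 ^ card U * (\<Sum>M\<in>Pow U. g M * g (sym_diff M (b \<times> w))))"
    by (simp only: sum_distrib_left)
  also have "\<dots> = (\<Sum>b\<in>Pow K. \<Sum>w\<in>Pow N. \<Sum>Y\<in>Pow U. G Y * chi Y (b \<times> w))"
    by (intro sum.cong refl fourier) (auto simp: U_def)
  also have "\<dots> = (\<Sum>b\<in>Pow K. \<Sum>Y\<in>Pow U. \<Sum>w\<in>Pow N. G Y * chi Y (b \<times> w))"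
    by (intro sum.cong refl sum.swap)
  also have "\<dots> = (\<Sum>Y\<in>Pow U. \<Sum>b\<in>Pow K. \<Sum>w\<in>Pow N. G Y * chi Y (b \<times> w))"
    by (rule sum.swap)
  also have "\<dots> = (\<Sum>Y\<in>Pow U. G Y * (\<Sum>b\<in>Pow K. \<Sum>w\<in>Pow N. chi Y (b \<times> w)))"
    by (simp add: sum_distrib_left)
  also have "\<dots> \<le> (\<Sum>Y\<in>Pow U. BN / 2 * (G Y + (if Y = {} then G {} else 0)))"
  proof (rule sum_mono)
    fix Y assume Y: "Y \<in> Pow U"
    show "G Y * (\<Sum>b\<in>Pow K. \<Sum>w\<in>Pow N. chi Y (b \<times> w)) \<le> BN / 2 * (G Y + (if Y = {} then G {} else 0))"
    proof (cases "Y = {}")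
      case True
      then show ?thesis using K N by (simp add: BN_def card_Pow)
    next
      case False
      have "G Y * (\<Sum>b\<in>Pow K. \<Sum>w\<in>Pow N. chi Y (b \<times> w)) \<le> G Y * (BN / 2)"
        using sum_chi_Times_le[OF K N, of Y] False Y
        by (intro mult_left_mono) (auto simp: U_def BN_def G_def)
      then show ?thesis using False by (simp add: mult_ac)
    qed
  qed
  also have "\<dots> = BN / 2 * ((\<Sum>Y\<in>Pow U. G Y) + G {})"
    unfolding sum_distrib_left[symmetric] sum.distrib using U by (simp add: sum.delta)
  also have "\<dots> = 2 ^ card U * (BN / 2 * ((\<Sum>M\<in>Pow U. (g M)\<^sup>2) + (\<Sum>M\<in>Pow U. g M)\<^sup>2 / 2 ^ card U))"
    unfolding parseval G0 by (simp add: field_simps)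
  finally show ?thesis by (subst (asm) mult_le_cancel_left_pos) (simp_all add: BN_def)
qed

text \<open>Since \<open>\<psi> = 1\<close> wherever \<open>h = 1\<close>, the covariance of \<open>h\<close> and \<open>\<psi>\<close> is \<open>\<beta> (1 - \<alpha>)\<close>, which
  Cauchy-Schwarz bounds by the two variances.\<close>

lemma correlation_contract:
  fixes h \<psi> :: "'t \<Rightarrow> real" and \<alpha> \<beta> :: real
  assumes T: "finite T" "T \<noteq> {}"
    and h: "\<And>t. t \<in> T \<Longrightarrow> h t = 0 \<or> h t = 1"
    and h\<psi>: "\<And>t. t \<in> T \<Longrightarrow> h t = 1 \<Longrightarrow> \<psi> t = 1"
    and \<beta>: "(\<Sum>t\<in>T. h t) = card T * \<beta>"
    and \<alpha>: "(\<Sum>t\<in>T. \<psi> t) = card T * \<alpha>" "0 \<le> \<alpha>" "\<alpha> \<le> 1"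
    and sq: "(\<Sum>t\<in>T. (\<psi> t)\<^sup>2) \<le> card T * ((\<alpha> + \<alpha>\<^sup>2) / 2)"
  shows "\<beta> * (1 - \<alpha>) \<le> \<alpha> * (1 - \<beta>) / 2"
proof -
  define c where "c = real (card T)"
  have c: "c > 0" using T by (simp add: c_def card_gt_0_iff)
  have "c * \<beta> \<ge> 0" unfolding c_def \<beta>[symmetric] by (intro sum_nonneg) (use h in force)
  then have \<beta>0: "\<beta> \<ge> 0" using c by (simp add: zero_le_mult_iff)
  have "c * \<beta> \<le> (\<Sum>t\<in>T. 1)" unfolding c_def \<beta>[symmetric] by (intro sum_mono) (use h in force)
  then have \<beta>1: "\<beta> \<le> 1" using c by (simp add: c_def[symmetric])
  have 1: "(\<Sum>t\<in>T. (h t - \<beta>) * (\<psi> t - \<alpha>)) = c * (\<beta> * (1 - \<alpha>))"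
  proof -
    have "(\<Sum>t\<in>T. (h t - \<beta>) * (\<psi> t - \<alpha>)) = (\<Sum>t\<in>T. h t * (1 - \<alpha>) - \<beta> * \<psi> t + \<beta> * \<alpha>)"
      by (intro sum.cong refl) (use h h\<psi> in \<open>force simp: algebra_simps\<close>)
    also have "\<dots> = (c * \<beta>) * (1 - \<alpha>) - \<beta> * (c * \<alpha>) + c * (\<beta> * \<alpha>)"
      by (simp add: sum.distrib sum_subtractf sum_distrib_left[symmetric] sum_distrib_right[symmetric]
          \<beta> \<alpha> c_def)
    finally show ?thesis by (simp add: algebra_simps)
  qed
  have 2: "(\<Sum>t\<in>T. (h t - \<beta>)\<^sup>2) = c * (\<beta> * (1 - \<beta>))"
  proof -
    have "(\<Sum>t\<in>T. (h t - \<beta>)\<^sup>2) = (\<Sum>t\<in>T. h t * (1 - 2 * \<beta>) + \<beta>\<^sup>2)"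
      by (intro sum.cong refl) (use h in \<open>force simp: power2_eq_square algebra_simps\<close>)
    also have "\<dots> = (c * \<beta>) * (1 - 2 * \<beta>) + c * \<beta>\<^sup>2"
      by (simp add: sum.distrib sum_distrib_right[symmetric] \<beta> c_def)
    finally show ?thesis by (simp add: power2_eq_square algebra_simps)
  qed
  have 3: "(\<Sum>t\<in>T. (\<psi> t - \<alpha>)\<^sup>2) \<le> c * (\<alpha> * (1 - \<alpha>) / 2)"
  proof -
    have "(\<Sum>t\<in>T. (\<psi> t - \<alpha>)\<^sup>2) = (\<Sum>t\<in>T. (\<psi> t)\<^sup>2 - 2 * \<alpha> * \<psi> t + \<alpha>\<^sup>2)"
      by (intro sum.cong refl) (simp add: power2_eq_square algebra_simps)
    also have "\<dots> = (\<Sum>t\<in>T. (\<psi> t)\<^sup>2) - 2 * \<alpha> * (c * \<alpha>) + c * \<alpha>\<^sup>2"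
      by (simp add: sum.distrib sum_subtractf sum_distrib_left[symmetric] \<alpha> c_def)
    also have "\<dots> \<le> c * ((\<alpha> + \<alpha>\<^sup>2) / 2) - 2 * \<alpha> * (c * \<alpha>) + c * \<alpha>\<^sup>2"
      using sq by (simp add: c_def)
    finally show ?thesis by (simp add: power2_eq_square algebra_simps)
  qed
  have "(c * (\<beta> * (1 - \<alpha>)))\<^sup>2 \<le> (\<Sum>t\<in>T. (h t - \<beta>)\<^sup>2) * (\<Sum>t\<in>T. (\<psi> t - \<alpha>)\<^sup>2)"
    unfolding 1[symmetric] by (rule Cauchy_Schwarz_ineq_sum)
  also have "\<dots> \<le> c * (\<beta> * (1 - \<beta>)) * (c * (\<alpha> * (1 - \<alpha>) / 2))"
    unfolding 2 using 3 c \<beta>0 \<beta>1 by (intro mult_left_mono) auto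
  \<comment> \<open>Regrouping the product of the two variances exposes the common factor
    \<open>\<beta> * (1 - \<alpha>)\<close>; cancelling it turns the squared inequality into the
    comparison of odds.\<close>
  finally have "c\<^sup>2 * ((\<beta> * (1 - \<alpha>)) * (\<beta> * (1 - \<alpha>))) \<le> c\<^sup>2 * ((\<beta> * (1 - \<alpha>)) * (\<alpha> * (1 - \<beta>) / 2))"
    by (simp add: power2_eq_square algebra_simps)
  then have le: "(\<beta> * (1 - \<alpha>)) * (\<beta> * (1 - \<alpha>)) \<le> (\<beta> * (1 - \<alpha>)) * (\<alpha> * (1 - \<beta>) / 2)"
    using c by (subst (asm) mult_le_cancel_left_pos) simp_all
  show ?thesis
  proof (cases "\<beta> * (1 - \<alpha>) = 0")
    case True
    moreover have "0 \<le> \<alpha> * (1 - \<beta>)" using \<alpha> \<beta>1 by simp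
    ultimately show ?thesis by linarith
  next
    case False
    then have "\<beta> * (1 - \<alpha>) > 0" using \<beta>0 \<alpha> by (simp add: less_le)
    then show ?thesis using le by (simp only: mult_le_cancel_left_pos)
  qed
qed

section \<open>Row spaces of matrices over F_2\<close>

definition rowspace :: "nat \<Rightarrow> (nat \<times> 'b) set \<Rightarrow> 'b set set" where
  "rowspace k M = (\<lambda>b. lincomb b M) ` Pow {..<k}"

lemma lincomb_sym_diff:
  assumes "finite b" "finite c"
  shows "lincomb (sym_diff b c) M = sym_diff (lincomb b M) (lincomb c M)"
proof -
  have "{i \<in> sym_diff b c. (i, j) \<in> M} = sym_diff {i\<in>b. (i, j) \<in> M} {i\<in>c. (i, j) \<in> M}" for j
    by auto
  then show ?thesis
    using assms by (auto simp: lincomb_def even_card_sym_diff simp del: Un_iff Diff_iff)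
qed

lemma lincomb_subset:
  assumes "M \<subseteq> K \<times> N"
  shows "lincomb b M \<subseteq> N"
proof
  fix j assume "j \<in> lincomb b M"
  then have "{i\<in>b. (i, j) \<in> M} \<noteq> {}" unfolding lincomb_def by (metis (no_types, lifting) card.empty even_zero mem_Collect_eq)
  then show "j \<in> N" using assms by auto
qed

lemma f2subspace_rowspace:
  assumes "M \<subseteq> {..<k} \<times> {..<n}"
  shows "f2subspace n (rowspace k M)"
  unfolding f2subspace_def
proof (intro conjI ballI)
  show "rowspace k M \<subseteq> f2vec n"
    using lincomb_subset[OF assms] by (auto simp: rowspace_def f2vec_def)
  have "lincomb {} M = {}" by (simp add: lincomb_def)
  then show "{} \<in> rowspace k M" by (auto simp: rowspace_def image_iff intro!: bexI[of _ "{}"])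
next
  fix u v assume "u \<in> rowspace k M" "v \<in> rowspace k M"
  then obtain b c where bc: "b \<subseteq> {..<k}" "c \<subseteq> {..<k}" "u = lincomb b M" "v = lincomb c M"
    by (auto simp: rowspace_def)
  then have "finite b" "finite c" using finite_subset by auto
  then have "f2add u v = lincomb (sym_diff b c) M"
    by (simp add: bc lincomb_sym_diff f2add_def)
  moreover have "sym_diff b c \<in> Pow {..<k}" using bc by auto
  ultimately show "f2add u v \<in> rowspace k M" by (simp only: rowspace_def image_eqI)
qed

text \<open>Adding \<open>b\<close> \<open>w\<close>^T to \<open>M\<close> adds \<open>w\<close> to
  the rows in \<open>b\<close>, so the combination \<open>x\<close> of the new rows is the old one
  plus \<open>w\<close> times the parity of \<open>x \<inter> b\<close>. The appended row
  \<open>k\<close> supplies that multiple of \<open>w\<close>.\<close>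

lemma rowspace_add_rank_one_subset:
  assumes M: "M \<subseteq> {..<k} \<times> N" and b: "b \<subseteq> {..<k}"
  shows "rowspace k (sym_diff M (b \<times> w)) \<subseteq> rowspace (Suc k) (M \<union> {k} \<times> w)"
proof
  fix v assume "v \<in> rowspace k (sym_diff M (b \<times> w))"
  then obtain x where x: "x \<subseteq> {..<k}" "v = lincomb x (sym_diff M (b \<times> w))"
    by (auto simp: rowspace_def)
  have fx: "finite x" using x finite_subset by auto
  define y where "y = (if odd (card (x \<inter> b)) then insert k x else x)"
  have "j \<in> lincomb x (sym_diff M (b \<times> w)) \<longleftrightarrow> j \<in> lincomb y (M \<union> {k} \<times> w)" for j
  proof -
    define c where "c = {i\<in>x. (i, j) \<in> M}"
    have c: "finite c" "k \<notin> c" "k \<notin> x" "(k, j) \<notin> M" using fx x M by (auto simp: c_def)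
    have l: "{i\<in>x. (i, j) \<in> sym_diff M (b \<times> w)} = (if j \<in> w then sym_diff c (x \<inter> b) else c)"
      by (auto simp: c_def)
    have r: "{i\<in>y. (i, j) \<in> M \<union> {k} \<times> w} = (if j \<in> w \<and> odd (card (x \<inter> b)) then insert k c else c)"
      using c by (auto simp: c_def y_def)
    show ?thesis
      unfolding lincomb_def mem_Collect_eq l r
      using c even_card_sym_diff[of c "x \<inter> b"] fx by simp
  qed
  then have "v = lincomb y (M \<union> {k} \<times> w)" using x by auto
  moreover have "y \<in> Pow {..<Suc k}" using x by (auto simp: y_def)
  ultimately show "v \<in> rowspace (Suc k) (M \<union> {k} \<times> w)" by (auto simp: rowspace_def)
qed

text \<open>A uniform matrix with \<open>k + 1\<close> rows is a uniform matrix with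
  \<open>k\<close> rows plus an independent uniform row; this couples consecutive values of
  \<open>k\<close>.\<close>

lemma bij_betw_append_row:
  "bij_betw (\<lambda>(M, w). M \<union> {k} \<times> w) (Pow ({..<k} \<times> N) \<times> Pow N) (Pow ({..<Suc k} \<times> N))"
  by (rule bij_betw_byWitness[where f' = "\<lambda>M. ({z\<in>M. fst z < k}, {j. (k, j) \<in> M})"])
     (auto simp: less_Suc_eq)

section \<open>Decay of the hit probability with the number of rows\<close>

definition hit_prob :: "nat \<Rightarrow> nat \<Rightarrow> nat set set set \<Rightarrow> real" where
  "hit_prob n k Q = (\<Sum>M\<in>Pow ({..<k} \<times> {..<n}). of_bool (rowspace k M \<in> Q)) / 2 ^ (k * n)"

lemma hit_prob_bounds: "0 \<le> hit_prob n k Q" "hit_prob n k Q \<le> 1"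
proof -
  have "(\<Sum>M\<in>Pow ({..<k} \<times> {..<n}). of_bool (rowspace k M \<in> Q)) \<le> (\<Sum>M\<in>Pow ({..<k} \<times> {..<n}). 1 :: real)"
    by (intro sum_mono) auto
  then show "hit_prob n k Q \<le> 1" by (simp add: hit_prob_def card_Pow)
qed (simp add: hit_prob_def sum_nonneg)

text \<open>The odds at least halve, stated without denominators so that probability 1 is covered.
  In the coupling, \<open>h\<close> tests the extended matrix and \<open>\<psi>\<close> is the
  fraction of noisy matrices \<open>M + b w^T\<close> that hit \<open>Q\<close>; downward closure
  makes \<open>\<psi>\<close> equal 1 wherever \<open>h\<close> does.\<close>

lemma hit_prob_Suc:
  assumes Q: "subspace_ideal n Q"
  shows "hit_prob n (Suc k) Q * (1 - hit_prob n k Q) \<le> hit_prob n k Q * (1 - hit_prob n (Suc k) Q) / 2"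
proof -
  define K N U where "K = {..<k}" and "N = {..<n}" and "U = K \<times> N"
  define T where "T = Pow U \<times> Pow N"
  have fin: "finite K" "finite N" "finite U" by (simp_all add: K_def N_def U_def)
  have cT: "real (card T) = 2 ^ (k * n) * 2 ^ n"
    by (simp add: T_def U_def K_def N_def card_cartesian_product card_Pow)
  define g :: "(nat \<times> nat) set \<Rightarrow> real" where "g M = of_bool (rowspace k M \<in> Q)" for M
  define h :: "(nat \<times> nat) set \<times> nat set \<Rightarrow> real"
    where "h = (\<lambda>(M, w). of_bool (rowspace (Suc k) (M \<union> {k} \<times> w) \<in> Q))"
  define \<psi> where "\<psi> = (\<lambda>(M, w). (\<Sum>b\<in>Pow K. g (sym_diff M (b \<times> w))) / 2 ^ k)"
  define \<alpha> where "\<alpha> = hit_prob n k Q"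
  define \<beta> where "\<beta> = hit_prob n (Suc k) Q"
  have g: "(\<Sum>M\<in>Pow U. g M) = 2 ^ (k * n) * \<alpha>"
    by (simp add: \<alpha>_def hit_prob_def g_def U_def K_def N_def)
  have shift: "(\<Sum>M\<in>Pow U. p (sym_diff M (b \<times> w))) = (\<Sum>M\<in>Pow U. p M)"
    if "b \<subseteq> K" "w \<subseteq> N" for b w and p :: "_ \<Rightarrow> real"
    using that by (intro sum_Pow_sym_diff) (auto simp: U_def)
  have "\<beta> * (1 - \<alpha>) \<le> \<alpha> * (1 - \<beta>) / 2"
  proof (rule correlation_contract)
    show "finite T" "T \<noteq> {}" using fin by (auto simp: T_def)
    show "h t = 0 \<or> h t = 1" for t by (auto simp: h_def split: prod.split)
    show "\<psi> t = 1" if t: "t \<in> T" "h t = 1" for t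
    proof -
      obtain M w where Mw: "t = (M, w)" "M \<subseteq> U" "w \<subseteq> N" using t by (auto simp: T_def)
      have R: "rowspace (Suc k) (M \<union> {k} \<times> w) \<in> Q" using t Mw by (auto simp: h_def)
      have "g (sym_diff M (b \<times> w)) = 1" if b: "b \<in> Pow K" for b
      proof -
        have "f2subspace n (rowspace k (sym_diff M (b \<times> w)))"
          by (rule f2subspace_rowspace) (use Mw b in \<open>auto simp: U_def K_def N_def\<close>)
        moreover have "rowspace k (sym_diff M (b \<times> w)) \<subseteq> rowspace (Suc k) (M \<union> {k} \<times> w)"
          by (rule rowspace_add_rank_one_subset) (use Mw b in \<open>auto simp: U_def K_def\<close>)
        ultimately have "rowspace k (sym_diff M (b \<times> w)) \<in> Q"
          using Q R unfolding subspace_ideal_def by blast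
        then show ?thesis by (simp add: g_def)
      qed
      then show ?thesis by (simp add: \<psi>_def Mw card_Pow K_def)
    qed
    have "(\<Sum>t\<in>T. h t) = (\<Sum>M\<in>Pow ({..<Suc k} \<times> N). of_bool (rowspace (Suc k) M \<in> Q))"
      unfolding T_def U_def K_def
      by (subst sum.reindex_bij_betw[OF bij_betw_append_row, symmetric])
         (simp add: h_def split_def)
    then show "(\<Sum>t\<in>T. h t) = card T * \<beta>"
      by (simp add: \<beta>_def hit_prob_def cT N_def power_add)
    have "(\<Sum>t\<in>T. \<psi> t) = (\<Sum>w\<in>Pow N. \<Sum>M\<in>Pow U. \<psi> (M, w))"
      unfolding T_def by (subst sum.swap) (simp add: sum.cartesian_product)
    also have "\<dots> = (\<Sum>w\<in>Pow N. \<Sum>b\<in>Pow K. \<Sum>M\<in>Pow U. g (sym_diff M (b \<times> w)) / 2 ^ k)"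
      unfolding \<psi>_def split_conv sum_divide_distrib by (intro sum.cong refl sum.swap)
    also have "\<dots> = (\<Sum>w\<in>Pow N. \<Sum>b\<in>Pow K. 2 ^ (k * n) * \<alpha> / 2 ^ k)"
      by (intro sum.cong refl) (simp add: sum_divide_distrib[symmetric] shift g)
    also have "\<dots> = card T * \<alpha>"
      using fin by (simp add: cT card_Pow) (simp add: K_def N_def)
    finally show "(\<Sum>t\<in>T. \<psi> t) = card T * \<alpha>" .
    show "0 \<le> \<alpha>" "\<alpha> \<le> 1" by (simp_all add: \<alpha>_def hit_prob_bounds)
    \<comment> \<open>The square of the average involves two shifts, by \<open>b \<times> w\<close>
      and \<open>c \<times> w\<close>. Translating \<open>M\<close> by the first leaves a single
      shift by \<open>sym_diff c b \<times> w\<close>, and \<open>sym_diff c b\<close> runs over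
      \<open>Pow K\<close> as \<open>c\<close> does, so the second moment is the noise
      correlation.\<close>
    have "(\<Sum>t\<in>T. (\<psi> t)\<^sup>2) = (\<Sum>w\<in>Pow N. \<Sum>M\<in>Pow U. (\<psi> (M, w))\<^sup>2)"
      unfolding T_def by (subst sum.swap) (simp add: sum.cartesian_product)
    also have "\<dots> = (\<Sum>w\<in>Pow N. \<Sum>b\<in>Pow K. \<Sum>M\<in>Pow U. g M * g (sym_diff M (b \<times> w))) / 2 ^ k"
      unfolding sum_divide_distrib[of _ "Pow N"]
    proof (rule sum.cong[OF refl])
      fix w assume w: "w \<in> Pow N"
      have "(\<Sum>M\<in>Pow U. (\<psi> (M, w))\<^sup>2) = (\<Sum>M\<in>Pow U. \<Sum>b\<in>Pow K. \<Sum>c\<in>Pow K.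
          g (sym_diff M (b \<times> w)) * g (sym_diff M (c \<times> w))) / (2 ^ k)\<^sup>2"
        by (simp add: \<psi>_def power_divide power2_eq_square sum_product sum_divide_distrib)
      also have "(\<Sum>M\<in>Pow U. \<Sum>b\<in>Pow K. \<Sum>c\<in>Pow K. g (sym_diff M (b \<times> w)) * g (sym_diff M (c \<times> w)))
        = (\<Sum>b\<in>Pow K. \<Sum>c\<in>Pow K. \<Sum>M\<in>Pow U. g (sym_diff M (b \<times> w)) * g (sym_diff M (c \<times> w)))"
        by (subst sum.swap, rule sum.cong[OF refl], rule sum.swap)
      also have "\<dots> = (\<Sum>b\<in>Pow K. \<Sum>c\<in>Pow K. \<Sum>M\<in>Pow U. g M * g (sym_diff M (c \<times> w)))"
      proof (rule sum.cong[OF refl])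
        fix b assume b: "b \<in> Pow K"
        define p where "p c = (\<Sum>M\<in>Pow U. g M * g (sym_diff M (c \<times> w)))" for c
        have "(\<Sum>M\<in>Pow U. g (sym_diff M (b \<times> w)) * g (sym_diff M (c \<times> w))) = p (sym_diff c b)" for c
        proof -
          have "sym_diff M (c \<times> w) = sym_diff (sym_diff M (b \<times> w)) (sym_diff c b \<times> w)" for M
            by blast
          then have "(\<Sum>M\<in>Pow U. g (sym_diff M (b \<times> w)) * g (sym_diff M (c \<times> w)))
            = (\<Sum>M\<in>Pow U. g (sym_diff M (b \<times> w)) * g (sym_diff (sym_diff M (b \<times> w)) (sym_diff c b \<times> w)))"
            by presburger
          also have "\<dots> = p (sym_diff c b)"
            unfolding p_def
            using b w by (intro shift[where p = "\<lambda>M. g M * g (sym_diff M (sym_diff c b \<times> w))"]) auto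
          finally show ?thesis .
        qed
        then show "(\<Sum>c\<in>Pow K. \<Sum>M\<in>Pow U. g (sym_diff M (b \<times> w)) * g (sym_diff M (c \<times> w)))
          = (\<Sum>c\<in>Pow K. p c)"
          using b sum_Pow_sym_diff[of b K p] by auto
      qed
      also have "\<dots> = 2 ^ k * (\<Sum>c\<in>Pow K. \<Sum>M\<in>Pow U. g M * g (sym_diff M (c \<times> w)))"
        using fin by (simp add: card_Pow) (simp add: K_def)
      finally show "(\<Sum>M\<in>Pow U. (\<psi> (M, w))\<^sup>2)
        = (\<Sum>c\<in>Pow K. \<Sum>M\<in>Pow U. g M * g (sym_diff M (c \<times> w))) / 2 ^ k"
        by (simp add: power2_eq_square)
    qed
    also have "\<dots> = (\<Sum>b\<in>Pow K. \<Sum>w\<in>Pow N. \<Sum>M\<in>Pow U. g M * g (sym_diff M (b \<times> w))) / 2 ^ k"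
      by (subst sum.swap) (rule refl)
    also have "\<dots> \<le> (2 ^ card K * 2 ^ card N *
          ((\<Sum>M\<in>Pow U. (g M)\<^sup>2) + (\<Sum>M\<in>Pow U. g M)\<^sup>2 / 2 ^ card U) / 2) / 2 ^ k"
      using rank_one_noise[OF fin(1,2), of g] unfolding U_def
      by (rule divide_right_mono) simp
    also have "(\<Sum>M\<in>Pow U. (g M)\<^sup>2) = (\<Sum>M\<in>Pow U. g M)"
      by (intro sum.cong) (auto simp: g_def)
    also have "2 ^ card K * 2 ^ card N *
          ((\<Sum>M\<in>Pow U. g M) + (\<Sum>M\<in>Pow U. g M)\<^sup>2 / 2 ^ card U) / 2 / 2 ^ k = card T * ((\<alpha> + \<alpha>\<^sup>2) / 2)"
      unfolding g cT
      by (simp add: U_def K_def N_def card_cartesian_product power2_eq_square field_simps)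
    finally show "(\<Sum>t\<in>T. (\<psi> t)\<^sup>2) \<le> card T * ((\<alpha> + \<alpha>\<^sup>2) / 2)" .
  qed
  then show ?thesis by (simp add: \<alpha>_def \<beta>_def)
qed

text \<open>With \<open>t\<close> the square root of the odds of \<open>p\<close>, this is \<open>t / (1 + t)\<close>, written so that
  \<open>p = 1\<close> needs no special treatment.\<close>

definition threshold_potential :: "real \<Rightarrow> real" where
  "threshold_potential p = sqrt p / (sqrt p + sqrt (1 - p))"

lemma threshold_potential_bounds:
  assumes "0 \<le> p" "p \<le> 1"
  shows "0 \<le> threshold_potential p" "threshold_potential p \<le> 1"
  using assms by (auto simp: threshold_potential_def divide_le_eq_1 add_nonneg_nonneg add_nonneg_eq_0_iff less_le)

text \<open>Halving the odds shrinks their square root by a constant factor, so the potential drops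
  noticeably unless \<open>\<alpha>\<close> is near 0 or 1. The drop is
  \<open>(a * b' - b * a') / ((a + a') * (b + b'))\<close>, with numerator at least
  \<open>a * b' / 4\<close> and denominator at most 2, whence the 8.\<close>

lemma sqrt_variance_le_potential_drop:
  assumes \<alpha>: "0 \<le> \<alpha>" "\<alpha> \<le> 1" and \<beta>: "0 \<le> \<beta>" "\<beta> \<le> 1"
    and drop: "\<beta> * (1 - \<alpha>) \<le> \<alpha> * (1 - \<beta>) / 2"
  shows "sqrt (\<alpha> * (1 - \<alpha>)) \<le> 8 * (threshold_potential \<alpha> - threshold_potential \<beta>)"
proof -
  define a a' b b' where "a = sqrt \<alpha>" and "a' = sqrt (1 - \<alpha>)" and "b = sqrt \<beta>" and "b' = sqrt (1 - \<beta>)"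
  have nn: "0 \<le> a" "0 \<le> a'" "0 \<le> b" "0 \<le> b'" using \<alpha> \<beta> by (simp_all add: a_def a'_def b_def b'_def)
  have sq: "a\<^sup>2 = \<alpha>" "a'\<^sup>2 = 1 - \<alpha>" "b\<^sup>2 = \<beta>" "b'\<^sup>2 = 1 - \<beta>"
    using \<alpha> \<beta> by (simp_all add: a_def a'_def b_def b'_def)
  \<comment> \<open>The factor 3/4 is a rational upper bound for the square root of 1/2, since 1/2
    is at most 9/16.\<close>
  have "(b * a')\<^sup>2 \<le> (3/4 * (a * b'))\<^sup>2"
  proof -
    have "0 \<le> \<alpha> * (1 - \<beta>)" using \<alpha> \<beta> by simp
    then have "\<beta> * (1 - \<alpha>) \<le> 9/16 * (\<alpha> * (1 - \<beta>))" using drop by linarith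
    then show ?thesis by (simp add: power_mult_distrib sq power_divide)
  qed
  then have ba: "b * a' \<le> 3/4 * (a * b')" by (rule power2_le_imp_le) (use nn in simp)
  have "\<beta> \<le> \<alpha>"
  proof -
    have "0 \<le> \<alpha> * (1 - \<beta>)" using \<alpha> \<beta> by simp
    then have "\<beta> * (1 - \<alpha>) \<le> \<alpha> * (1 - \<beta>)" using drop by linarith
    then show ?thesis by (simp add: algebra_simps)
  qed
  then have "a' \<le> b'" by (simp add: a'_def b'_def)
  then have aa: "a * a' \<le> a * b'" using nn by (intro mult_left_mono) auto
  have pos: "0 < a + a'" "0 < b + b'"
    using sq nn \<alpha> \<beta> by (auto simp: add_nonneg_eq_0_iff less_le)
  \<comment> \<open>Both \<open>(a, a')\<close> and \<open>(b, b')\<close> are unit vectors; the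
    bound is read off from a sum of three squares.\<close>
  have "(a + a') * (b + b') \<le> 2"
  proof -
    have "0 \<le> (a - a')\<^sup>2 + (b - b')\<^sup>2 + (a + a' - (b + b'))\<^sup>2" by simp
    moreover have "(a - a')\<^sup>2 = 1 - 2 * (a * a')" "(b - b')\<^sup>2 = 1 - 2 * (b * b')"
      using sq by (simp_all add: power2_diff)
    moreover have "(a + a' - (b + b'))\<^sup>2 = (1 + 2 * (a * a')) + (1 + 2 * (b * b')) - 2 * ((a + a') * (b + b'))"
      using sq by (simp add: power2_diff power2_sum)
    ultimately show ?thesis by linarith
  qed
  moreover have "0 \<le> a * b'" using nn by simp
  ultimately have "(a * b') * ((a + a') * (b + b')) \<le> (a * b') * 2" by (intro mult_left_mono)
  also have "\<dots> \<le> 8 * (a * b' - b * a')" using ba by (simp add: algebra_simps)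
  finally have "(a * b') * ((a + a') * (b + b')) \<le> 8 * (a * b' - b * a')" .
  moreover have "threshold_potential \<alpha> - threshold_potential \<beta> = (a * b' - b * a') / ((a + a') * (b + b'))"
    using pos unfolding threshold_potential_def a_def[symmetric] a'_def[symmetric] b_def[symmetric] b'_def[symmetric]
    by (simp add: diff_frac_eq algebra_simps)
  ultimately have "a * b' \<le> 8 * (threshold_potential \<alpha> - threshold_potential \<beta>)"
    using pos by (simp add: pos_le_divide_eq mult_pos_pos)
  moreover have "sqrt (\<alpha> * (1 - \<alpha>)) = a * a'" by (simp add: a_def a'_def real_sqrt_mult)
  ultimately show ?thesis using aa by linarith
qed

text \<open>The potential drops telescope, and the potential stays in [0, 1]. Each ideal thus has a
  constant total budget over all \<open>k\<close>, independent of \<open>n\<close> and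
  \<open>K\<close>.\<close>

lemma sum_sqrt_hit_prob_le:
  assumes "subspace_ideal n Q"
  shows "(\<Sum>k\<in>{1..K}. sqrt (hit_prob n k Q * (1 - hit_prob n k Q))) \<le> 8"
proof -
  have "(\<Sum>k\<in>{1..K}. sqrt (hit_prob n k Q * (1 - hit_prob n k Q)))
      \<le> (\<Sum>k<Suc K. sqrt (hit_prob n k Q * (1 - hit_prob n k Q)))"
    by (intro sum_mono2) (auto simp: hit_prob_bounds)
  also have "\<dots> \<le> (\<Sum>k<Suc K. 8 * (threshold_potential (hit_prob n k Q) - threshold_potential (hit_prob n (Suc k) Q)))"
    by (intro sum_mono sqrt_variance_le_potential_drop hit_prob_bounds hit_prob_Suc assms)
  also have "\<dots> = 8 * (threshold_potential (hit_prob n 0 Q) - threshold_potential (hit_prob n (Suc K) Q))"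
    using sum_lessThan_telescope'[of "\<lambda>k. threshold_potential (hit_prob n k Q)" "Suc K"]
    by (simp only: sum_distrib_left[symmetric])
  also have "\<dots> \<le> 8"
    using threshold_potential_bounds[OF hit_prob_bounds, of n 0 Q]
      threshold_potential_bounds[OF hit_prob_bounds, of n "Suc K" Q] by simp
  finally show ?thesis .
qed

subsection \<open>Guessing from few bits of entropy\<close>

text \<open>With \<open>s = sqrt p\<close>, the bound \<open>ln (1 / s) \<le> 1 / s - 1\<close>
  gives \<open>2 * (s * (1 - s))\<close>. Used for \<open>p\<close> and \<open>1 - p\<close>
  together, it bounds the binary entropy by four standard deviations, the quantity controlled
  above.\<close>

lemma minus_ln_le_sqrt:
  fixes p :: real
  assumes "0 \<le> p" "p \<le> 1"
  shows "p * (- ln p) \<le> 2 * sqrt (p * (1 - p))"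
proof (cases "p = 0")
  case False
  define s where "s = sqrt p"
  have s: "0 < s" "s \<le> 1" "p = s\<^sup>2" using assms False by (simp_all add: s_def less_le)
  have "ln (1 / s) \<le> 1 / s - 1" using s by (intro ln_le_minus_one) simp
  then have "- ln p \<le> 2 * (1 / s - 1)" using s by (simp add: ln_realpow ln_div)
  then have "p * (- ln p) \<le> p * (2 * (1 / s - 1))" using assms by (intro mult_left_mono)
  also have "\<dots> = 2 * (s * (1 - s))" using s by (simp add: field_simps power2_eq_square)
  also have "\<dots> \<le> 2 * sqrt (p * (1 - p))"
  proof -
    have "(s * (1 - s))\<^sup>2 = p * ((1 - s) * (1 - s))" using s by (simp add: power2_eq_square algebra_simps)
    also have "\<dots> \<le> p * ((1 + s) * (1 - s))"
      using s assms by (intro mult_left_mono mult_right_mono) auto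
    also have "\<dots> = p * (1 - p)" using s by (simp add: power2_eq_square algebra_simps)
    finally show ?thesis by (simp add: real_le_rsqrt)
  qed
  finally show ?thesis .
qed simp

text \<open>The product measure \<open>\<mu>\<close> with the marginals of \<open>S\<close> serves as a reference: the expectation of
  \<open>- ln (\<mu> (S \<omega>))\<close> is the sum of the marginal entropies, so by Markov \<open>S \<omega>\<close> is usually one of
  the at most \<open>exp L\<close> sets of \<open>\<mu>\<close>-weight at least \<open>exp (- L)\<close>, and those are handled by a
  union bound.\<close>

lemma guess_prob_le:
  fixes S :: "'w \<Rightarrow> 'i set" and F :: "'i set \<Rightarrow> 'v" and A :: "'w \<Rightarrow> 'v set" and a :: "'i \<Rightarrow> real" and L \<epsilon> :: real
  assumes \<Omega>: "finite \<Omega>" "\<Omega> \<noteq> {}" and I: "finite I" and S: "\<And>\<omega>. \<omega> \<in> \<Omega> \<Longrightarrow> S \<omega> \<subseteq> I"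
    and L: "L > 0" and \<epsilon>: "\<epsilon> \<ge> 0"
    and F: "\<And>T. T \<subseteq> I \<Longrightarrow> (\<Sum>\<omega>\<in>\<Omega>. of_bool (F T \<in> A \<omega>)) \<le> card \<Omega> * \<epsilon>"
    and a: "\<And>i. i \<in> I \<Longrightarrow> (\<Sum>\<omega>\<in>\<Omega>. of_bool (i \<in> S \<omega>)) = card \<Omega> * a i"
  shows "(\<Sum>\<omega>\<in>\<Omega>. of_bool (F (S \<omega>) \<in> A \<omega>))
    \<le> card \<Omega> * ((\<Sum>i\<in>I. 4 * sqrt (a i * (1 - a i))) / L + exp L * \<epsilon>)"
proof -
  have c: "real (card \<Omega>) > 0" using \<Omega> by (simp add: card_gt_0_iff)
  have a': "(\<Sum>\<omega>\<in>\<Omega>. of_bool (i \<notin> S \<omega>)) = card \<Omega> * (1 - a i)" if "i \<in> I" for i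
  proof -
    have "(\<Sum>\<omega>\<in>\<Omega>. of_bool (i \<notin> S \<omega>)) = (\<Sum>\<omega>\<in>\<Omega>. 1 - of_bool (i \<in> S \<omega>) :: real)"
      by (intro sum.cong) auto
    then show ?thesis using a[OF that] by (simp add: sum_subtractf algebra_simps)
  qed
  have a0: "a i \<ge> 0" if "i \<in> I" for i
    using a[OF that] c sum_nonneg[of \<Omega> "\<lambda>\<omega>. of_bool (i \<in> S \<omega>) :: real"] by (simp add: zero_le_mult_iff)
  have a1: "a i \<le> 1" if "i \<in> I" for i
    using a'[OF that] c sum_nonneg[of \<Omega> "\<lambda>\<omega>. of_bool (i \<notin> S \<omega>) :: real"] by (simp add: zero_le_mult_iff)
  \<comment> \<open>Every outcome that occurs has positive marginal factors, so no logarithm of zero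
    enters the cost of \<open>S \<omega>\<close> and \<open>exp (- cost (S \<omega>))\<close> really
    is its \<open>\<mu>\<close>-weight.\<close>
  have pos: "a i > 0" if "\<omega> \<in> \<Omega>" "i \<in> I" "i \<in> S \<omega>" for i \<omega>
  proof -
    have "(\<Sum>\<omega>\<in>\<Omega>. of_bool (i \<in> S \<omega>) :: real) > 0"
      using that \<Omega> by (intro sum_pos2[of _ \<omega>]) auto
    then show ?thesis using a[OF that(2)] c by (simp add: zero_less_mult_iff)
  qed
  have pos': "1 - a i > 0" if "\<omega> \<in> \<Omega>" "i \<in> I" "i \<notin> S \<omega>" for i \<omega>
  proof -
    have "(\<Sum>\<omega>\<in>\<Omega>. of_bool (i \<notin> S \<omega>) :: real) > 0"
      using that \<Omega> by (intro sum_pos2[of _ \<omega>]) auto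
    then show ?thesis using a'[OF that(2)] c by (simp add: zero_less_mult_iff)
  qed
  define \<mu> where "\<mu> T = (\<Prod>i\<in>I. if i \<in> T then a i else 1 - a i)" for T
  define cost where "cost T = (\<Sum>i\<in>I. if i \<in> T then - ln (a i) else - ln (1 - a i))" for T
  define Y where "Y = {T\<in>Pow I. \<mu> T \<ge> exp (- L)}"
  have \<mu>0: "\<mu> T \<ge> 0" for T unfolding \<mu>_def by (intro prod_nonneg) (use a0 a1 in auto)
  have "(\<Sum>T\<in>Pow I. \<mu> T) = (\<Sum>T\<in>Pow I. (\<Prod>i\<in>T. a i) * (\<Prod>i\<in>I - T. 1 - a i))"
  proof (rule sum.cong[OF refl])
    fix T assume "T \<in> Pow I"
    then have "I \<inter> {i. i \<in> T} = T" "I \<inter> - {i. i \<in> T} = I - T" by auto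
    then show "\<mu> T = (\<Prod>i\<in>T. a i) * (\<Prod>i\<in>I - T. 1 - a i)"
      unfolding \<mu>_def using I by (simp add: prod.If_cases)
  qed
  also have "\<dots> = 1" using prod_add[OF I, of a "\<lambda>i. 1 - a i"] by simp
  finally have \<mu>_sum: "(\<Sum>T\<in>Pow I. \<mu> T) = 1" .
  have Y: "finite Y" using I by (simp add: Y_def)
  have cY: "card Y \<le> exp L"
  proof -
    have "card Y * exp (- L) = (\<Sum>T\<in>Y. exp (- L))" by simp
    also have "\<dots> \<le> (\<Sum>T\<in>Y. \<mu> T)" by (intro sum_mono) (simp add: Y_def)
    also have "\<dots> \<le> (\<Sum>T\<in>Pow I. \<mu> T)"
      using I \<mu>0 by (intro sum_mono2) (auto simp: Y_def)
    finally show ?thesis by (simp add: \<mu>_sum exp_minus field_simps)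
  qed
  have cost_nonneg: "cost (S \<omega>) \<ge> 0" if "\<omega> \<in> \<Omega>" for \<omega>
    unfolding cost_def
    by (intro sum_nonneg) (use a0 a1 pos[OF that] pos'[OF that] in auto)
  have exp_cost: "exp (- cost (S \<omega>)) = \<mu> (S \<omega>)" if "\<omega> \<in> \<Omega>" for \<omega>
    unfolding cost_def \<mu>_def sum_negf[symmetric] exp_sum[OF I]
    by (intro prod.cong refl) (use pos[OF that] pos'[OF that] in auto)
  \<comment> \<open>Markov's inequality and the union bound in one pointwise form: outside
    \<open>Y\<close> the cost exceeds \<open>L\<close>, inside \<open>Y\<close> the term
    \<open>T = S \<omega>\<close> of the sum suffices.\<close>
  have pointwise: "of_bool (F (S \<omega>) \<in> A \<omega>) \<le> cost (S \<omega>) / L + (\<Sum>T\<in>Y. of_bool (F T \<in> A \<omega>))"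
    if \<omega>: "\<omega> \<in> \<Omega>" for \<omega>
  proof (cases "S \<omega> \<in> Y")
    case True
    have "of_bool (F (S \<omega>) \<in> A \<omega>) \<le> (\<Sum>T\<in>Y. of_bool (F T \<in> A \<omega>) :: real)"
      using True Y by (intro member_le_sum) auto
    then show ?thesis using cost_nonneg[OF \<omega>] L by (simp add: add_increasing)
  next
    case False
    then have "exp (- cost (S \<omega>)) < exp (- L)" using S[OF \<omega>] exp_cost[OF \<omega>] by (auto simp: Y_def)
    then have "1 \<le> cost (S \<omega>) / L" using L by simp
    then show ?thesis by (intro add_increasing2 sum_nonneg) auto
  qed
  have "(\<Sum>\<omega>\<in>\<Omega>. of_bool (F (S \<omega>) \<in> A \<omega>))
      \<le> (\<Sum>\<omega>\<in>\<Omega>. cost (S \<omega>) / L + (\<Sum>T\<in>Y. of_bool (F T \<in> A \<omega>)))"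
    by (intro sum_mono pointwise)
  also have "\<dots> = (\<Sum>\<omega>\<in>\<Omega>. cost (S \<omega>)) / L + (\<Sum>T\<in>Y. \<Sum>\<omega>\<in>\<Omega>. of_bool (F T \<in> A \<omega>))"
    by (simp only: sum.distrib sum_divide_distrib sum.swap[of _ \<Omega> Y])
  also have "\<dots> \<le> card \<Omega> * (\<Sum>i\<in>I. 4 * sqrt (a i * (1 - a i))) / L + card \<Omega> * (exp L * \<epsilon>)"
  proof (intro add_mono divide_right_mono)
    have "(\<Sum>\<omega>\<in>\<Omega>. cost (S \<omega>)) = (\<Sum>i\<in>I. \<Sum>\<omega>\<in>\<Omega>. of_bool (i \<in> S \<omega>) * (- ln (a i)) + of_bool (i \<notin> S \<omega>) * (- ln (1 - a i)))"
      unfolding cost_def by (subst sum.swap, intro sum.cong refl) auto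
    also have "\<dots> = (\<Sum>i\<in>I. card \<Omega> * a i * (- ln (a i)) + card \<Omega> * (1 - a i) * (- ln (1 - a i)))"
      by (intro sum.cong refl) (simp only: sum.distrib sum_distrib_right[symmetric] a a')
    also have "\<dots> \<le> (\<Sum>i\<in>I. card \<Omega> * (4 * sqrt (a i * (1 - a i))))"
    proof (rule sum_mono)
      fix i assume i: "i \<in> I"
      have "a i * (- ln (a i)) + (1 - a i) * (- ln (1 - a i)) \<le> 4 * sqrt (a i * (1 - a i))"
        using minus_ln_le_sqrt[OF a0[OF i] a1[OF i]] minus_ln_le_sqrt[of "1 - a i"] a0[OF i] a1[OF i]
        by (simp add: mult.commute)
      then have "card \<Omega> * (a i * (- ln (a i)) + (1 - a i) * (- ln (1 - a i))) \<le> card \<Omega> * (4 * sqrt (a i * (1 - a i)))"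
        by (intro mult_left_mono) simp_all
      then show "card \<Omega> * a i * (- ln (a i)) + card \<Omega> * (1 - a i) * (- ln (1 - a i)) \<le> card \<Omega> * (4 * sqrt (a i * (1 - a i)))"
        by (simp add: algebra_simps)
    qed
    finally show "(\<Sum>\<omega>\<in>\<Omega>. cost (S \<omega>)) \<le> card \<Omega> * (\<Sum>i\<in>I. 4 * sqrt (a i * (1 - a i)))"
      by (simp add: sum_distrib_left)
    have "(\<Sum>T\<in>Y. \<Sum>\<omega>\<in>\<Omega>. of_bool (F T \<in> A \<omega>)) \<le> (\<Sum>T\<in>Y. card \<Omega> * \<epsilon>)"
      by (intro sum_mono F) (auto simp: Y_def)
    also have "\<dots> = card \<Omega> * (card Y * \<epsilon>)" by simp
    also have "\<dots> \<le> card \<Omega> * (exp L * \<epsilon>)"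
      using cY \<epsilon> by (intro mult_left_mono mult_right_mono) auto
    finally show "(\<Sum>T\<in>Y. \<Sum>\<omega>\<in>\<Omega>. of_bool (F T \<in> A \<omega>)) \<le> card \<Omega> * (exp L * \<epsilon>)" .
  qed (use L in simp)
  finally show ?thesis by (simp add: algebra_simps)
qed

section \<open>Random row spaces as hard instances\<close>

text \<open>Union bound over the coefficient vectors \<open>b\<close>. The empty \<open>b\<close>
  yields the zero vector, which is not \<open>x\<close>; for any other \<open>b\<close>, adding
  \<open>w\<close> to one row in \<open>b\<close> translates \<open>lincomb b M\<close> by
  \<open>w\<close>, so averaging over \<open>w\<close> leaves probability at most
  \<open>1 / 2 ^ n\<close>.\<close>

lemma sum_mem_rowspace_le:
  fixes x :: "nat set"
  assumes "x \<noteq> {}"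
  shows "(\<Sum>M\<in>Pow ({..<k} \<times> {..<n}). of_bool (x \<in> rowspace k M)) \<le> (2 ^ (k * n) * (2 ^ k / 2 ^ n) :: real)"
proof -
  define U where "U = {..<k} \<times> {..<n}"
  have cU: "finite (Pow U)" "card (Pow U) = 2 ^ (k * n)" by (simp_all add: U_def card_Pow card_cartesian_product)
  have main: "(\<Sum>M\<in>Pow U. of_bool (lincomb b M = x)) \<le> (2 ^ (k * n) / 2 ^ n :: real)" if b: "b \<subseteq> {..<k}" for b
  proof (cases "b = {}")
    case True
    then show ?thesis using assms by (simp add: lincomb_def)
  next
    case False
    then obtain i where i: "i \<in> b" by auto
    have fb: "finite b" using b finite_subset by auto
    have shift: "lincomb b (sym_diff M ({i} \<times> w)) = sym_diff (lincomb b M) w" for M and w :: "nat set"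
    proof -
      have "{i'\<in>b. (i', j) \<in> sym_diff M ({i} \<times> w)}
          = (if j \<in> w then sym_diff {i'\<in>b. (i', j) \<in> M} {i} else {i'\<in>b. (i', j) \<in> M})" for j
        using i by auto
      then show ?thesis
        using fb even_card_sym_diff[of "{i'\<in>b. (i', _) \<in> M}" "{i}"]
        by (auto simp: lincomb_def simp del: Un_iff Diff_iff split: if_splits)
    qed
    have "2 ^ n * (\<Sum>M\<in>Pow U. of_bool (lincomb b M = x)) = (\<Sum>w\<in>Pow {..<n}. \<Sum>M\<in>Pow U. of_bool (lincomb b M = x) :: real)"
      by (simp add: card_Pow)
    also have "\<dots> = (\<Sum>w\<in>Pow {..<n}. \<Sum>M\<in>Pow U. of_bool (lincomb b (sym_diff M ({i} \<times> w)) = x))"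
      by (intro sum.cong refl sum_Pow_sym_diff[symmetric]) (use i b in \<open>auto simp: U_def\<close>)
    also have "\<dots> = (\<Sum>M\<in>Pow U. \<Sum>w\<in>Pow {..<n}. of_bool (w = sym_diff (lincomb b M) x))"
    proof -
      have "sym_diff u w = x \<longleftrightarrow> w = sym_diff u x" for u w by blast
      then show ?thesis by (subst sum.swap) (simp only: shift)
    qed
    also have "\<dots> \<le> (\<Sum>M\<in>Pow U. 1)"
    proof (rule sum_mono)
      fix M
      have "(\<Sum>w\<in>Pow {..<n}. of_bool (w = z) :: real) \<le> 1" for z
        by (simp add: of_bool_def sum.delta)
      then show "(\<Sum>w\<in>Pow {..<n}. of_bool (w = sym_diff (lincomb b M) x) :: real) \<le> 1" .
    qed
    finally show ?thesis using cU by (simp add: field_simps)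
  qed
  have "(\<Sum>M\<in>Pow U. of_bool (x \<in> rowspace k M)) \<le> (\<Sum>M\<in>Pow U. \<Sum>b\<in>Pow {..<k}. of_bool (lincomb b M = x) :: real)"
  proof (rule sum_mono)
    fix M
    show "of_bool (x \<in> rowspace k M) \<le> (\<Sum>b\<in>Pow {..<k}. of_bool (lincomb b M = x) :: real)"
    proof (cases "x \<in> rowspace k M")
      case True
      then obtain b where b: "b \<in> Pow {..<k}" "lincomb b M = x" by (auto simp: rowspace_def)
      have "of_bool (lincomb b M = x) \<le> (\<Sum>b\<in>Pow {..<k}. of_bool (lincomb b M = x) :: real)"
        using b by (intro member_le_sum) auto
      then show ?thesis using b True by simp
    qed (simp add: sum_nonneg)
  qed
  also have "\<dots> = (\<Sum>b\<in>Pow {..<k}. \<Sum>M\<in>Pow U. of_bool (lincomb b M = x))" by (rule sum.swap)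
  also have "\<dots> \<le> (\<Sum>b\<in>Pow {..<k}. 2 ^ (k * n) / 2 ^ n)" by (intro sum_mono main) auto
  finally show ?thesis by (simp add: U_def card_Pow mult.commute)
qed

lemma rowspace_eq_zero_imp:
  assumes "M \<subseteq> {..<k} \<times> N" "rowspace k M = {{}}"
  shows "M = {}"
proof (rule ccontr)
  assume "M \<noteq> {}"
  then obtain i j where ij: "(i, j) \<in> M" by auto
  then have "{i} \<subseteq> {..<k}" using assms by auto
  then have "lincomb {i} M = {}" using assms by (auto simp: rowspace_def)
  moreover have "{i'\<in>{i}. (i', j) \<in> M} = {i}" using ij by auto
  then have "j \<in> lincomb {i} M" by (simp add: lincomb_def)
  ultimately show False by simp
qed


text \<open>This fixes the cost threshold \<open>n / 8\<close>. Using only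
  \<open>ln 2 \<ge> 1 / 2\<close>, the powers of two contribute at most
  \<open>exp (- n / 4)\<close>, and \<open>n \<ge> 120\<close> makes \<open>1 + n / 8\<close> at
  least 16.\<close>

lemma exp_mult_two_powers_le:
  assumes n: "n \<ge> 120" and k: "k \<le> n div 2"
  shows "exp (real n / 8) * (2 ^ k / 2 ^ n) \<le> 1 / 16"
proof -
  have pow: "(2::real) ^ j = exp (real j * ln 2)" for j by (simp add: exp_of_nat_mult)
  have "2 * real k \<le> real n" using k by linarith
  then have "real n / 4 \<le> (real n - real k) * (1 / 2)" by simp
  also have "\<dots> \<le> (real n - real k) * ln 2"
    using ln2_ge_two_thirds k by (intro mult_left_mono) auto
  finally have "real n / 8 + (real k * ln 2 - real n * ln 2) \<le> - (real n / 8)"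
    by (simp add: algebra_simps)
  then have "exp (real n / 8) * (2 ^ k / 2 ^ n) \<le> exp (- (real n / 8))"
    unfolding pow exp_diff[symmetric] exp_add[symmetric] by simp
  also have "\<dots> \<le> 1 / 16"
  proof -
    have "16 \<le> exp (real n / 8)" using exp_ge_add_one_self[of "real n / 8"] n by linarith
    then show ?thesis by (simp add: exp_minus field_simps)
  qed
  finally show ?thesis .
qed

text \<open>With the ideals fixed, only \<open>M\<close> is random, and the answers form the set
  \<open>S M\<close> of indices answered yes. The entropy bound applies with
  \<open>L = n / 8\<close>; the 32 is 4 times 8.\<close>

lemma success_prob_fixed_ideals_le:
  assumes n: "n \<ge> 120" and k: "k \<le> n div 2" and len: "length Qs = m"
    and f: "\<And>bs. length bs = m \<Longrightarrow> f bs \<noteq> {}"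
  shows "(\<Sum>M\<in>Pow ({..<k} \<times> {..<n}). of_bool (f (map (\<lambda>Q. rowspace k M \<in> Q) Qs) \<in> rowspace k M)) / 2 ^ (k * n)
    \<le> 32 / real n * (\<Sum>i<m. sqrt (hit_prob n k (Qs ! i) * (1 - hit_prob n k (Qs ! i)))) + 1 / 16"
proof -
  define \<Omega> where "\<Omega> = Pow ({..<k} \<times> {..<n})"
  have \<Omega>: "finite \<Omega>" "\<Omega> \<noteq> {}" "real (card \<Omega>) = 2 ^ (k * n)"
    by (auto simp: \<Omega>_def card_Pow card_cartesian_product)
  define S where "S M = {i. i < m \<and> rowspace k M \<in> Qs ! i}" for M
  define F where "F T = f (map (\<lambda>i. i \<in> T) [0..<m])" for T
  have FS: "F (S M) = f (map (\<lambda>Q. rowspace k M \<in> Q) Qs)" for M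
    unfolding F_def using len by (intro arg_cong[of _ _ f] nth_equalityI) (auto simp: S_def)
  have "(\<Sum>M\<in>\<Omega>. of_bool (F (S M) \<in> rowspace k M))
    \<le> card \<Omega> * ((\<Sum>i<m. 4 * sqrt (hit_prob n k (Qs ! i) * (1 - hit_prob n k (Qs ! i)))) / (real n / 8)
        + exp (real n / 8) * (2 ^ k / 2 ^ n))"
  proof (rule guess_prob_le[where S = S and F = F and A = "rowspace k"])
    show "(\<Sum>M\<in>\<Omega>. of_bool (F T \<in> rowspace k M)) \<le> card \<Omega> * (2 ^ k / 2 ^ n :: real)" for T
      unfolding \<Omega>(3) unfolding \<Omega>_def by (rule sum_mem_rowspace_le) (simp add: F_def f)
    show "(\<Sum>M\<in>\<Omega>. of_bool (i \<in> S M)) = card \<Omega> * hit_prob n k (Qs ! i)" if "i \<in> {..<m}" for i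
      using that unfolding \<Omega>(3) by (simp add: \<Omega>_def hit_prob_def S_def)
  qed (use \<Omega> n in \<open>auto simp: S_def\<close>)
  also have "\<dots> \<le> card \<Omega> * ((\<Sum>i<m. 4 * sqrt (hit_prob n k (Qs ! i) * (1 - hit_prob n k (Qs ! i)))) / (real n / 8) + 1 / 16)"
    using exp_mult_two_powers_le[OF n k] by (intro mult_left_mono add_left_mono) auto
  finally show ?thesis
    unfolding FS \<Omega>(3) unfolding \<Omega>_def sum_distrib_left[symmetric] by (simp add: field_simps)
qed

text \<open>Only the zero matrix has the zero row space, and it is at most half of all matrices
  because \<open>k * n \<ge> 1\<close>; the others contribute 1/2 each.\<close>

lemma success_prob_rowspace_ge:
  assumes k: "k \<ge> 1" and n: "n \<ge> 1"
    and hyp: "\<And>A. f2subspace n A \<Longrightarrow> A \<noteq> {{}} \<Longrightarrow> P A \<ge> 1 / 2" and P: "\<And>A. P A \<ge> (0 :: real)"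
  shows "(\<Sum>M\<in>Pow ({..<k} \<times> {..<n}). P (rowspace k M)) / 2 ^ (k * n) \<ge> 1 / 4"
proof -
  define \<Omega> where "\<Omega> = Pow ({..<k} \<times> {..<n})"
  have \<Omega>: "finite \<Omega>" "card \<Omega> = 2 ^ (k * n)" "{} \<in> \<Omega>"
    by (auto simp: \<Omega>_def card_Pow card_cartesian_product)
  have "(2::real) ^ 1 \<le> 2 ^ (k * n)" using k n by (intro power_increasing) auto
  then have "2 ^ (k * n) / 4 \<le> ((2 ^ (k * n) - 1) / 2 :: real)" by simp
  also have "\<dots> = (\<Sum>M\<in>\<Omega> - {{}}. 1 / 2)" using \<Omega> by (simp add: of_nat_diff)
  also have "\<dots> \<le> (\<Sum>M\<in>\<Omega> - {{}}. P (rowspace k M))"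
    using rowspace_eq_zero_imp
    by (intro sum_mono hyp f2subspace_rowspace) (auto simp: \<Omega>_def)
  also have "\<dots> \<le> (\<Sum>M\<in>\<Omega>. P (rowspace k M))"
    using \<Omega> P by (intro sum_mono2) auto
  finally show ?thesis by (simp add: \<Omega>_def field_simps)
qed

theorem theorem7:
  shows "\<exists>c::real. c > 0 \<and> (\<exists>n0::nat. \<forall>(n::nat) (m::nat)
            (p :: nat set set set list pmf) (f :: bool list \<Rightarrow> nat set).
     n \<ge> n0 \<longrightarrow> n \<ge> 1 \<longrightarrow>
     (\<forall>Qs\<in>set_pmf p. length Qs = m \<and> (\<forall>Q\<in>set Qs. subspace_ideal n Q)) \<longrightarrow>
     (\<forall>bs. length bs = m \<longrightarrow> f bs \<in> f2vec n \<and> f bs \<noteq> {}) \<longrightarrow>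
     (\<forall>A. f2subspace n A \<and> A \<noteq> {{}} \<longrightarrow>
        measure_pmf.prob p {Qs. f (map (\<lambda>Q. A \<in> Q) Qs) \<in> A} \<ge> 1/2) \<longrightarrow>
     real m \<ge> c * real n ^ 2)"
\<comment> \<open>The two bounds on the expected success summed over \<open>k\<close> give
  \<open>K / 4 \<le> 256 * m / n + K / 16\<close>, where 256 is 32 times the budget 8. With
  \<open>K \<ge> n / 3\<close> this is \<open>n / 16 \<le> 256 * m / n\<close>, and 4096 is 16 times
  256.\<close>
proof (intro exI[of _ "1 / 4096"] conjI exI[of _ 120] allI impI)
  fix n m :: nat and p :: "nat set set set list pmf" and f :: "bool list \<Rightarrow> nat set"
  assume n: "n \<ge> 120" "n \<ge> 1"
    and Qs: "\<forall>Qs\<in>set_pmf p. length Qs = m \<and> (\<forall>Q\<in>set Qs. subspace_ideal n Q)"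
    and f: "\<forall>bs. length bs = m \<longrightarrow> f bs \<in> f2vec n \<and> f bs \<noteq> {}"
    and hyp: "\<forall>A. f2subspace n A \<and> A \<noteq> {{}} \<longrightarrow>
        measure_pmf.prob p {Qs. f (map (\<lambda>Q. A \<in> Q) Qs) \<in> A} \<ge> 1/2"
  define K where "K = n div 2"
  define E where "E A = {Qs. f (map (\<lambda>Q. A \<in> Q) Qs) \<in> A}" for A
  \<comment> \<open>The success probability over random matrices for a fixed tuple, summed over
    \<open>k\<close>. Bounding it for each tuple in the support handles any joint distribution,
    while its expectation is bounded below by the hypothesis.\<close>
  define Z where "Z Qs = (\<Sum>k\<in>{1..K}. (\<Sum>M\<in>Pow ({..<k} \<times> {..<n}). indicat_real (E (rowspace k M)) Qs) / 2 ^ (k * n))" for Qs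
  have int: "integrable (measure_pmf p) (indicat_real (E A))" for A
    by (rule measure_pmf.integrable_const_bound[where B = 1]) (auto simp: indicator_def)
  have upper: "Z Qs \<le> 256 * m / n + K / 16" if "Qs \<in> set_pmf p" for Qs
  proof -
    have len: "length Qs = m" and id: "\<And>i. i < m \<Longrightarrow> subspace_ideal n (Qs ! i)"
      using that Qs by auto
    have "Z Qs \<le> (\<Sum>k\<in>{1..K}. 32 / real n * (\<Sum>i<m. sqrt (hit_prob n k (Qs ! i) * (1 - hit_prob n k (Qs ! i)))) + 1 / 16)"
      unfolding Z_def
    proof (rule sum_mono)
      fix k assume "k \<in> {1..K}"
      then have "k \<le> n div 2" by (simp add: K_def)
      from success_prob_fixed_ideals_le[OF n(1) this len, of f] f
      show "(\<Sum>M\<in>Pow ({..<k} \<times> {..<n}). indicat_real (E (rowspace k M)) Qs) / 2 ^ (k * n)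
        \<le> 32 / real n * (\<Sum>i<m. sqrt (hit_prob n k (Qs ! i) * (1 - hit_prob n k (Qs ! i)))) + 1 / 16"
        by (simp add: indicator_def E_def of_bool_def)
    qed
    also have "\<dots> = 32 / real n * (\<Sum>i<m. \<Sum>k\<in>{1..K}. sqrt (hit_prob n k (Qs ! i) * (1 - hit_prob n k (Qs ! i)))) + K / 16"
      by (subst sum.swap) (simp add: sum.distrib sum_distrib_left)
    also have "\<dots> \<le> 32 / real n * (\<Sum>i<m. 8) + K / 16"
      by (intro add_right_mono mult_left_mono sum_mono sum_sqrt_hit_prob_le id) auto
    finally show ?thesis by (simp add: field_simps)
  qed
  have "K / 4 = (\<Sum>k\<in>{1..K}. 1 / 4 :: real)" by simp
  also have "\<dots> \<le> (\<Sum>k\<in>{1..K}. (\<Sum>M\<in>Pow ({..<k} \<times> {..<n}). measure_pmf.prob p (E (rowspace k M))) / 2 ^ (k * n))"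
    using hyp n by (intro sum_mono success_prob_rowspace_ge) (auto simp: E_def)
  also have "\<dots> = measure_pmf.expectation p Z"
    unfolding Z_def using int by (simp add: integral_sum)
  also have "\<dots> \<le> 256 * m / n + K / 16"
  proof (rule measure_pmf.integral_le_const)
    show "integrable (measure_pmf p) Z"
      unfolding Z_def by (intro Bochner_Integration.integrable_sum integrable_divide int)
    show "AE Qs in measure_pmf p. Z Qs \<le> 256 * m / n + K / 16"
      using upper by (simp add: AE_measure_pmf_iff)
  qed
  finally have "3 / 16 * K \<le> 256 * m / n" by simp
  moreover have "real n / 3 \<le> K" using n unfolding K_def by linarith
  ultimately have "n / 16 \<le> 256 * m / n" by linarith
  then show "1 / 4096 * (real n)\<^sup>2 \<le> real m"
    using n by (simp add: field_simps power2_eq_square)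
qed simp

end
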